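(* (Condition A1 via weak balance elimination) Let $(\mathcal A,\mathcal A_0,(-))$ be a $\mathcal T$-semiring triple which is multiply balanced with respect to the balance relation $\nabla=\nabla_{(-)}$ and satisfies weak balance elimination. Then Condition A1 holds: for every matrix over $\mathcal A$, the submatrix rank is less than or equal to the row rank and the column rank.
   Context: $\mathcal T$ is a commutative multiplicative monoid with unit $1$, $\mathcal T_0=\mathcal T\cup\{0\}$. A semiring satisfies all ring axioms except existence of additive inverses ($0$ additively neutral and multiplicatively absorbing). A $\mathcal T$-semiring triple $(\mathcal A,\mathcal A_0,(-))$ consists of a semiring $\mathcal A$ containing $\mathcal T_0$, with $\mathcal T$ a multiplicative submonoid not containing $0$ acting by multiplication and $\mathcal T_0$ spanning $(\mathcal A,+)$ (so $\mathcal A$ is commutative); an additive sub-semigroup $\mathcal A_0\ni0$ closed under multiplication by $\mathcal T$, with $\mathcal A_0\cap\mathcal T_0=\{0\}$; and a negation map $(-)$: an automorphism of $(\mathcal A,+,0)$ of order $\le2$ leaving $\mathcal T$ invariant, with $1+((-)1)\in\mathcal A_0$ and $((-)a)b=(-)(ab)=a((-)b)$ for $a\in\mathcal T$, $b\in\mathcal A$. Write $b(-)b'=b+((-)b')$. Standing assumptions: for $a\in\mathcal T$, $ab\in\mathcal A_0$ implies $b\in\mathcal A_0$; $ab_1=ab_2$ implies $b_1=b_2$; and Property N: $a_1+a_2=a_1(-)a_1$ whenever $a_1,a_2\in\mathcal T$ and $a_1+a_2\in\mathcal A_0$. $b_1\nabla b_2$ means $b_1(-)b_2\in\mathcal A_0$.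 A set $S\subseteq\mathcal A$ is pairwise balanced if $b\nabla b'$ for all $b,b'\in S$. The triple is multiply balanced if for every pairwise balanced set $S$ there is $a\in\mathcal T_0$ with $a\nabla b$ for all $b\in S$. Weak balance elimination: for finitely many $a_j\in\mathcal T$ and $c_j,b_j,d\in\mathcal A$, the relations $(\sum_jb_ja_j)\nabla d$ and $a_j\nabla c_j$ (all $j$) together imply $(\sum_jb_jc_j)\nabla d$. Vectors $\mathbf v_i\in\mathcal A^{(n)}$ ($i\in I$) are dependent if $\sum_{i\in I'}a_i\mathbf v_i\in\mathcal A_0^{(n)}$ for some nonempty finite $I'\subseteq I$ and $a_i\in\mathcal T$; otherwise independent. Row (column) rank: the maximal number of independent rows (columns). $|A|=\sum_{\pi\in S_n}(-)^\pi a_{\pi(1),1}\cdots a_{\pi(n),n}$, with $(-)^\pi$ the identity for even $\pi$ and $(-)$ for odd $\pi$; $A$ is singular if $|A|\in\mathcal A_0$. Submatrix rank: the largest size of a nonsingular square submatrix. *)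

theory Defs
  imports "Jordan_Normal_Form.DL_Submatrix" "HOL-Combinatorics.Permutations"
begin

text \<open>
  The semiring is the whole type, of class \<^class>\<open>comm_semiring_1\<close>. Commutativity and
  \<open>0 \<noteq> 1\<close> are no restriction: the commutative monoid \<open>T\<close>, together with \<open>0\<close>, spans the semiring
  additively, and \<open>1 \<in> T\<close>, \<open>0 \<notin> T\<close>.
\<close>

locale semiring_triple =
  fixes T A0 :: "'a::comm_semiring_1 set" and neg :: "'a \<Rightarrow> 'a"
  assumes one_in_T: "1 \<in> T"
    and mult_in_T: "\<lbrakk>a \<in> T; b \<in> T\<rbrakk> \<Longrightarrow> a * b \<in> T"
    and zero_notin_T: "0 \<notin> T"
    and spanning: "\<exists>xs. set xs \<subseteq> insert 0 T \<and> b = sum_list xs"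
    and zero_in_A0: "0 \<in> A0"
    and add_in_A0: "\<lbrakk>x \<in> A0; y \<in> A0\<rbrakk> \<Longrightarrow> x + y \<in> A0"
    and mult_in_A0: "\<lbrakk>a \<in> T; x \<in> A0\<rbrakk> \<Longrightarrow> a * x \<in> A0"
    and A0_Int_T0: "A0 \<inter> insert 0 T = {0}"
    and neg_zero: "neg 0 = 0"
    and neg_add: "neg (b + b') = neg b + neg b'"
    and neg_neg: "neg (neg b) = b"
    and neg_in_T: "a \<in> T \<Longrightarrow> neg a \<in> T"
    and one_neg_one: "1 + neg 1 \<in> A0"
    and neg_mult_left: "a \<in> T \<Longrightarrow> neg a * b = neg (a * b)"
    and neg_mult_right: "a \<in> T \<Longrightarrow> a * neg b = neg (a * b)"

definition property_N :: "'a::comm_semiring_1 set \<Rightarrow> 'a set \<Rightarrow> ('a \<Rightarrow> 'a) \<Rightarrow> bool" where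
  "property_N T A0 neg \<longleftrightarrow>
    (\<forall>a1\<in>T. \<forall>a2\<in>T. a1 + a2 \<in> A0 \<longrightarrow> a1 + a2 = a1 + neg a1)"

definition balanced :: "'a::comm_semiring_1 set \<Rightarrow> ('a \<Rightarrow> 'a) \<Rightarrow> 'a \<Rightarrow> 'a \<Rightarrow> bool" where
  "balanced A0 neg b b' \<longleftrightarrow> b + neg b' \<in> A0"

definition pairwise_balanced ::
    "'a::comm_semiring_1 set \<Rightarrow> ('a \<Rightarrow> 'a) \<Rightarrow> 'a set \<Rightarrow> bool" where
  "pairwise_balanced A0 neg S \<longleftrightarrow> (\<forall>b\<in>S. \<forall>b'\<in>S. balanced A0 neg b b')"

definition multiply_balanced ::
    "'a::comm_semiring_1 set \<Rightarrow> 'a set \<Rightarrow> ('a \<Rightarrow> 'a) \<Rightarrow> bool" where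
  "multiply_balanced T A0 neg \<longleftrightarrow>
    (\<forall>S. pairwise_balanced A0 neg S \<longrightarrow> (\<exists>a\<in>insert 0 T. \<forall>b\<in>S. balanced A0 neg a b))"

definition weak_balance_elimination ::
    "'a::comm_semiring_1 set \<Rightarrow> 'a set \<Rightarrow> ('a \<Rightarrow> 'a) \<Rightarrow> bool" where
  "weak_balance_elimination T A0 neg \<longleftrightarrow>
    (\<forall>(m::nat) a b c d.
      (\<forall>j<m. a j \<in> T) \<and> balanced A0 neg (\<Sum>j<m. b j * a j) d \<and>
      (\<forall>j<m. balanced A0 neg (a j) (c j)) \<longrightarrow>
      balanced A0 neg (\<Sum>j<m. b j * c j) d)"

text \<open>
  Dependence is a property of indexed families, so repeated vectors count with their indices.
  The vectors are meant to have dimension \<open>n\<close>.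
\<close>

definition vecs_dependent ::
    "'a::comm_semiring_1 set \<Rightarrow> 'a set \<Rightarrow> nat \<Rightarrow> ('i \<Rightarrow> 'a vec) \<Rightarrow> 'i set \<Rightarrow> bool" where
  "vecs_dependent T A0 n v I \<longleftrightarrow>
    (\<exists>I' a. I' \<subseteq> I \<and> finite I' \<and> I' \<noteq> {} \<and> (\<forall>i\<in>I'. a i \<in> T) \<and>
      (\<forall>k<n. (\<Sum>i\<in>I'. a i * v i $ k) \<in> A0))"

definition triple_row_rank :: "'a::comm_semiring_1 set \<Rightarrow> 'a set \<Rightarrow> 'a mat \<Rightarrow> nat" where
  "triple_row_rank T A0 M =
    Max {card I | I. I \<subseteq> {..<dim_row M} \<and> \<not> vecs_dependent T A0 (dim_col M) (row M) I}"

definition triple_col_rank :: "'a::comm_semiring_1 set \<Rightarrow> 'a set \<Rightarrow> 'a mat \<Rightarrow> nat" where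
  "triple_col_rank T A0 M =
    Max {card J | J. J \<subseteq> {..<dim_col M} \<and> \<not> vecs_dependent T A0 (dim_row M) (col M) J}"

text \<open>Only meant for square matrices.\<close>

definition triple_det :: "('a::comm_semiring_1 \<Rightarrow> 'a) \<Rightarrow> 'a mat \<Rightarrow> 'a" where
  "triple_det neg M =
    (\<Sum>\<pi> | \<pi> permutes {..<dim_row M}.
      (if evenperm \<pi> then id else neg) (\<Prod>i<dim_row M. M $$ (\<pi> i, i)))"

definition triple_singular ::
    "'a::comm_semiring_1 set \<Rightarrow> ('a \<Rightarrow> 'a) \<Rightarrow> 'a mat \<Rightarrow> bool" where
  "triple_singular A0 neg M \<longleftrightarrow> triple_det neg M \<in> A0"

text \<open>
  The empty submatrix has determinant \<open>1 \<notin> A0\<close>, so a matrix without nonsingular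
  square submatrices of positive size gets submatrix rank \<open>0\<close>.
\<close>

definition submatrix_rank ::
    "'a::comm_semiring_1 set \<Rightarrow> ('a \<Rightarrow> 'a) \<Rightarrow> 'a mat \<Rightarrow> nat" where
  "submatrix_rank A0 neg M =
    Max {card I | I J. I \<subseteq> {..<dim_row M} \<and> J \<subseteq> {..<dim_col M} \<and> card I = card J \<and>
      \<not> triple_singular A0 neg (submatrix M I J)}"

definition condition_A1 ::
    "'a::comm_semiring_1 set \<Rightarrow> 'a set \<Rightarrow> ('a \<Rightarrow> 'a) \<Rightarrow> bool" where
  "condition_A1 T A0 neg \<longleftrightarrow>
    (\<forall>M. submatrix_rank A0 neg M \<le> triple_row_rank T A0 M \<and>
         submatrix_rank A0 neg M \<le> triple_col_rank T A0 M)"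

text \<open>The sets under the maxima are finite and nonempty.\<close>

lemma row_rank_set:
  "finite {card I | I. I \<subseteq> {..<dim_row M} \<and> \<not> vecs_dependent T A0 (dim_col M) (row M) I}"
  "0 \<in> {card I | I. I \<subseteq> {..<dim_row M} \<and> \<not> vecs_dependent T A0 (dim_col M) (row M) I}"
proof -
  show "finite {card I | I. I \<subseteq> {..<dim_row M} \<and> \<not> vecs_dependent T A0 (dim_col M) (row M) I}"
    by (rule finite_subset[of _ "card ` Pow {..<dim_row M}"]) auto
  have "\<not> vecs_dependent T A0 (dim_col M) (row M) {}"
    by (auto simp: vecs_dependent_def)
  then show "0 \<in> {card I | I. I \<subseteq> {..<dim_row M} \<and> \<not> vecs_dependent T A0 (dim_col M) (row M) I}"
    by (auto intro!: exI[of _ "{}"])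
qed

lemma col_rank_set:
  "finite {card J | J. J \<subseteq> {..<dim_col M} \<and> \<not> vecs_dependent T A0 (dim_row M) (col M) J}"
  "0 \<in> {card J | J. J \<subseteq> {..<dim_col M} \<and> \<not> vecs_dependent T A0 (dim_row M) (col M) J}"
proof -
  show "finite {card J | J. J \<subseteq> {..<dim_col M} \<and> \<not> vecs_dependent T A0 (dim_row M) (col M) J}"
    by (rule finite_subset[of _ "card ` Pow {..<dim_col M}"]) auto
  have "\<not> vecs_dependent T A0 (dim_row M) (col M) {}"
    by (auto simp: vecs_dependent_def)
  then show "0 \<in> {card J | J. J \<subseteq> {..<dim_col M} \<and> \<not> vecs_dependent T A0 (dim_row M) (col M) J}"
    by (auto intro!: exI[of _ "{}"])
qed

lemma (in semiring_triple) submatrix_rank_set: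
  "finite {card I | I J. I \<subseteq> {..<dim_row M} \<and> J \<subseteq> {..<dim_col M} \<and> card I = card J \<and>
      \<not> triple_singular A0 neg (submatrix M I J)}"
  "0 \<in> {card I | I J. I \<subseteq> {..<dim_row M} \<and> J \<subseteq> {..<dim_col M} \<and> card I = card J \<and>
      \<not> triple_singular A0 neg (submatrix M I J)}"
proof -
  show "finite {card I | I J. I \<subseteq> {..<dim_row M} \<and> J \<subseteq> {..<dim_col M} \<and> card I = card J \<and>
      \<not> triple_singular A0 neg (submatrix M I J)}"
    by (rule finite_subset[of _ "card ` Pow {..<dim_row M}"]) auto
  have "1 \<notin> A0"
    using A0_Int_T0 one_in_T zero_notin_T by (metis IntI insertCI singletonD)
  moreover have "triple_det neg (submatrix M {} {}) = 1"
    by (simp add: triple_det_def dim_submatrix evenperm_id[unfolded id_def])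
  ultimately have "\<not> triple_singular A0 neg (submatrix M {} {})"
    by (simp add: triple_singular_def)
  then show "0 \<in> {card I | I J. I \<subseteq> {..<dim_row M} \<and> J \<subseteq> {..<dim_col M} \<and> card I = card J \<and>
      \<not> triple_singular A0 neg (submatrix M I J)}"
    by (auto intro!: exI[of _ "{}"])
qed

end

theory Submission
  imports Defs
begin

text \<open>
  A dependence between rows or columns of a square matrix is a vector \<open>x\<close> with entries in
  \<open>T \<union> {0}\<close>, not all zero, whose product with the matrix (or its transpose) lies in \<open>A0\<close>. So the
  theorem reduces to one claim: such a kernel vector forces the determinant into \<open>A0\<close>
  (\<open>signed_det_kernel_in_A0\<close>). A dependence among the rows of a large matrix restricts to the rows
  of a submatrix, so the rows and columns that carry a nonsingular submatrix are independent.

  Over a field the claim is Cramer's rule. Expand along a row \<open>m\<close> and let \<open>D k\<close> be the cofactor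
  of the entry in column \<open>k\<close>. The cofactors are proportional to \<open>x\<close>, hence the
  determinant is proportional to the \<open>m\<close>-th entry of the product, which vanishes. Over a triple,
  proportionality only survives as the balances \<open>x l * D k \<nabla> x k * D l\<close>, and \<open>\<nabla>\<close> need not be
  transitive. But when the denominators are cleared, the elements \<open>y k * D k\<close> for \<open>k\<close> in the
  support of \<open>x\<close>, where \<open>y k\<close> is the product of the nonzero entries of \<open>x\<close> other than \<open>x k\<close>, are
  pairwise balanced, so multiple balance supplies one \<open>t \<in> T \<union> {0}\<close> that
  balances all of them. This \<open>t\<close> is the missing factor of proportionality: \<open>x k * t\<close> balances
  \<open>P * D k\<close> for the product \<open>P\<close> of all nonzero entries. For \<open>t \<noteq> 0\<close> the elements \<open>x k * t\<close> lie in
  \<open>T\<close>, so weak balance elimination may replace them by \<open>P * D k\<close> in the relation of row \<open>m\<close>;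
  this puts \<open>P\<close> times the support's share of the expansion into \<open>A0\<close>, and \<open>P\<close> cancels. For
  \<open>t = 0\<close> the cofactors on the support are already in \<open>A0\<close>, and off the support they always are.

  What is needed about the cofactors comes from the claim itself, by induction. The combination
  \<open>x l * D k (-) x k * D l\<close> is the determinant of the matrix in which columns \<open>k\<close> and \<open>l\<close> are
  merged into \<open>x l * c\<^sub>l + x k * c\<^sub>k\<close> and row \<open>m\<close> is a unit row at \<open>k\<close>
  (\<open>signed_det_merge_columns\<close>). Setting the entry of \<open>x\<close> at \<open>k\<close> to \<open>0\<close> and at \<open>l\<close> to \<open>1\<close> gives
  a kernel vector of the merged matrix. Instead of deleting row \<open>m\<close> and column \<open>k\<close>, which would
  require reindexing, the proof keeps all matrices of the same size and counts the rows that
  have not yet been made zero on the support of the vector.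
\<close>

section \<open>Determinants with a formal sign\<close>

text \<open>
  The negation of a triple is multiplication by the element \<open>e\<close> obtained by negating \<open>1\<close>, and
  \<open>e * e = 1\<close>. With \<open>e\<close> in the role of \<open>-1\<close>, the identities below hold in every commutative semiring.
\<close>
definition perm_sign :: "'a::comm_semiring_1 \<Rightarrow> ('i \<Rightarrow> 'i) \<Rightarrow> 'a" where
  "perm_sign e p = (if evenperm p then 1 else e)"

definition signed_det :: "'a::comm_semiring_1 \<Rightarrow> 'i set \<Rightarrow> ('i \<Rightarrow> 'i \<Rightarrow> 'a) \<Rightarrow> 'a" where
  "signed_det e N f = (\<Sum>p | p permutes N. perm_sign e p * (\<Prod>i\<in>N. f i (p i)))"

definition unit_row :: "'i \<Rightarrow> 'i \<Rightarrow> 'a::comm_semiring_1" where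
  "unit_row k j = (if j = k then 1 else 0)"

lemma signed_det_cong:
  assumes "\<And>i j. i \<in> N \<Longrightarrow> j \<in> N \<Longrightarrow> f i j = g i j"
  shows "signed_det e N f = signed_det e N g"
  unfolding signed_det_def
proof (rule sum.cong[OF refl])
  fix p assume "p \<in> {p. p permutes N}"
  then have "(\<Prod>i\<in>N. f i (p i)) = (\<Prod>i\<in>N. g i (p i))"
    by (intro prod.cong[OF refl] assms) (simp_all add: permutes_in_image)
  then show "perm_sign e p * (\<Prod>i\<in>N. f i (p i)) = perm_sign e p * (\<Prod>i\<in>N. g i (p i))"
    by simp
qed

text \<open>
  Inversion permutes the summands: a permutation and its inverse have the same parity.
\<close>
lemma signed_det_transpose:
  assumes "finite N"
  shows "signed_det e N (\<lambda>i j. f j i) = signed_det e N f"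
proof -
  have "signed_det e N (\<lambda>i j. f j i)
      = (\<Sum>p | p permutes N. perm_sign e (inv_into UNIV p) * (\<Prod>i\<in>N. f (inv_into UNIV p i) i))"
    unfolding signed_det_def by (rule sum_permutations_inverse)
  also have "\<dots> = signed_det e N f"
    unfolding signed_det_def
  proof (rule sum.cong[OF refl])
    fix p assume "p \<in> {p. p permutes N}"
    then have p: "p permutes N" by simp
    have "perm_sign e (inv_into UNIV p) = perm_sign e p"
      using permutes_imp_permutation[OF assms p] by (simp add: perm_sign_def evenperm_inv)
    moreover have "(\<Prod>i\<in>N. f (inv_into UNIV p i) i) = (\<Prod>i\<in>N. f i (p i))"
      using prod.permute[OF p, of "\<lambda>i. f (inv_into UNIV p i) i"] by (simp add: permutes_inverses(2)[OF p])
    ultimately show "perm_sign e (inv_into UNIV p) * (\<Prod>i\<in>N. f (inv_into UNIV p i) i)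
        = perm_sign e p * (\<Prod>i\<in>N. f i (p i))" by simp
  qed
  finally show ?thesis .
qed

text \<open>
  The entry of the row \<open>m\<close> is separated from the part of each summand that does not involve this
  row; linearity and expansion along a row are then statements about sums.
\<close>
lemma signed_det_row:
  assumes "finite N" "m \<in> N"
  shows "signed_det e N (f(m := r))
    = (\<Sum>p | p permutes N. r (p m) * (perm_sign e p * (\<Prod>i\<in>N-{m}. f i (p i))))"
  unfolding signed_det_def
proof (rule sum.cong[OF refl])
  fix p :: "'a \<Rightarrow> 'a"
  have "(\<Prod>i\<in>N. (f(m := r)) i (p i)) = r (p m) * (\<Prod>i\<in>N-{m}. f i (p i))"
    using assms by (subst prod.remove[OF assms]) (auto intro!: arg_cong2[of _ _ _ _ "(*)"] prod.cong)
  then show "perm_sign e p * (\<Prod>i\<in>N. (f(m := r)) i (p i))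
      = r (p m) * (perm_sign e p * (\<Prod>i\<in>N-{m}. f i (p i)))"
    by (simp add: ac_simps)
qed

lemma signed_det_row_linear:
  assumes "finite N" "m \<in> N"
  shows "signed_det e N (f(m := (\<lambda>j. a * r j + b * s j)))
    = a * signed_det e N (f(m := r)) + b * signed_det e N (f(m := s))"
  by (simp add: signed_det_row[OF assms] sum.distrib sum_distrib_left algebra_simps)

lemma signed_det_column_linear:
  assumes "finite N" "l \<in> N"
  shows "signed_det e N (\<lambda>i j. if j = l then a * c i + b * d i else f i j)
    = a * signed_det e N (\<lambda>i j. if j = l then c i else f i j)
      + b * signed_det e N (\<lambda>i j. if j = l then d i else f i j)"
proof -
  have *: "signed_det e N (\<lambda>i j. if j = l then c i else f i j)
      = signed_det e N ((\<lambda>j i. f i j)(l := c))" for c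
    using signed_det_transpose[OF assms(1), of e "(\<lambda>j i. f i j)(l := c)"]
    by (simp add: fun_upd_def if_distrib[of "\<lambda>h. h _"] cong: if_cong)
  show ?thesis unfolding * by (rule signed_det_row_linear[OF assms])
qed

text \<open>
  The cofactor of the entry at \<open>(m, k)\<close> is expressed, with its sign, as the determinant with row \<open>m\<close>
  replaced by a unit row, so that no minors of smaller size and no reindexing occur.
\<close>
lemma signed_det_expand_row:
  assumes "finite N" "m \<in> N"
  shows "signed_det e N f = (\<Sum>k\<in>N. f m k * signed_det e N (f(m := unit_row k)))"
proof -
  let ?w = "\<lambda>p. perm_sign e p * (\<Prod>i\<in>N-{m}. f i (p i))"
  have "signed_det e N f = signed_det e N (f(m := f m))" by simp
  also have "\<dots> = (\<Sum>p | p permutes N. f m (p m) * ?w p)"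
    by (rule signed_det_row[OF assms])
  also have "\<dots> = (\<Sum>p | p permutes N. \<Sum>k\<in>N. f m k * (unit_row k (p m) * ?w p))"
  proof (rule sum.cong[OF refl])
    fix p assume "p \<in> {p. p permutes N}"
    then have "p m \<in> N" using assms(2) by (simp add: permutes_in_image)
    have "(\<Sum>k\<in>N. f m k * (unit_row k (p m) * ?w p))
        = (\<Sum>k\<in>N. if p m = k then f m k * ?w p else 0)"
      by (intro sum.cong[OF refl]) (simp add: unit_row_def)
    then show "f m (p m) * ?w p = (\<Sum>k\<in>N. f m k * (unit_row k (p m) * ?w p))"
      using \<open>p m \<in> N\<close> assms(1) by (simp add: sum.delta')
  qed
  also have "\<dots> = (\<Sum>k\<in>N. f m k * signed_det e N (f(m := unit_row k)))"
    by (subst sum.swap) (simp add: signed_det_row[OF assms] sum_distrib_left)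
  finally show ?thesis .
qed

lemma signed_det_zero_column:
  assumes "finite N" "q \<in> N" "\<And>i. i \<in> N \<Longrightarrow> f i q = 0"
  shows "signed_det e N f = 0"
proof -
  have "signed_det e N f = signed_det e N (\<lambda>i j. f j i)"
    by (rule signed_det_transpose[OF assms(1), symmetric])
  also have "\<dots> = (\<Sum>k\<in>N. f k q * signed_det e N ((\<lambda>i j. f j i)(q := unit_row k)))"
    by (rule signed_det_expand_row[OF assms(1,2)])
  also have "\<dots> = 0" by (simp add: assms(3))
  finally show ?thesis .
qed

lemma perm_sign_transpose_comp:
  assumes "finite N" "p permutes N" "k \<noteq> l" "e * e = 1"
  shows "perm_sign e (Transposition.transpose k l \<circ> p) = e * perm_sign e p"
  using assms permutes_imp_permutation[OF assms(1,2)]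
  by (simp add: perm_sign_def evenperm_comp permutation_swap_id evenperm_swap)

text \<open>
  The matrix on the left has unit row \<open>k\<close> in place of row \<open>m\<close> and column \<open>k\<close> copied over column
  \<open>l\<close>. Swapping columns \<open>k\<close> and \<open>l\<close> moves the unit entry to column \<open>l\<close> and the copy of column \<open>k\<close>
  back to its place. Off row \<open>m\<close>, column \<open>l\<close> of the result differs from that of \<open>f\<close>, but a nonzero
  summand takes the unit entry in row \<open>m\<close> and hence no other entry of column \<open>l\<close>.
\<close>
lemma signed_det_swap_unit:
  assumes "finite N" "m \<in> N" "k \<in> N" "l \<in> N" "k \<noteq> l" "e * e = 1"
  shows "signed_det e N ((\<lambda>i j. if j = l then f i k else f i j)(m := unit_row k))
    = e * signed_det e N (f(m := unit_row l))"
  (is "signed_det e N ?g = _")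
proof -
  let ?t = "Transposition.transpose k l"
  have t: "?t permutes N" using assms by (simp add: permutes_swap_id)
  have "signed_det e N (f(m := unit_row l))
     = (\<Sum>p | p permutes N. perm_sign e (?t \<circ> p) * (\<Prod>i\<in>N. (f(m := unit_row l)) i ((?t \<circ> p) i)))"
    unfolding signed_det_def by (rule setum_permutations_compose_left[OF t])
  also have "\<dots> = (\<Sum>p | p permutes N. e * (perm_sign e p * (\<Prod>i\<in>N. ?g i (p i))))"
  proof (rule sum.cong[OF refl])
    fix p assume "p \<in> {p. p permutes N}"
    then have p: "p permutes N" by simp
    have inj: "p i = p j \<longleftrightarrow> i = j" for i j using permutes_inj[OF p] by (simp add: inj_eq)
    have "(\<Prod>i\<in>N. (f(m := unit_row l)) i ((?t \<circ> p) i)) = (\<Prod>i\<in>N. ?g i (p i))"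
    \<comment> \<open>Unless \<open>p\<close> sends \<open>m\<close> to \<open>k\<close>, both products contain a zero of the unit row.\<close>
    proof (cases "p m = k")
      case True
      show ?thesis
      proof (rule prod.cong[OF refl])
        fix i assume "i \<in> N"
        show "(f(m := unit_row l)) i ((?t \<circ> p) i) = ?g i (p i)"
        proof (cases "i = m")
          case True with \<open>p m = k\<close> show ?thesis by (simp add: unit_row_def)
        next
          case False
          then have "p i \<noteq> k" using \<open>p m = k\<close> inj by metis
          then show ?thesis using False by (auto simp: Transposition.transpose_def)
        qed
      qed
    next
      case False
      have "(f(m := unit_row l)) m ((?t \<circ> p) m) = 0"
        using False by (auto simp: unit_row_def Transposition.transpose_def)
      moreover have "?g m (p m) = 0" using False by (simp add: unit_row_def)
      ultimately show ?thesis
        using prod.remove[OF assms(1,2), of "\<lambda>i. (f(m := unit_row l)) i ((?t \<circ> p) i)"]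
          prod.remove[OF assms(1,2), of "\<lambda>i. ?g i (p i)"] by (simp only: mult_zero_left)
    qed
    then show "perm_sign e (?t \<circ> p) * (\<Prod>i\<in>N. (f(m := unit_row l)) i ((?t \<circ> p) i))
        = e * (perm_sign e p * (\<Prod>i\<in>N. ?g i (p i)))"
      by (simp only: perm_sign_transpose_comp[OF assms(1) p assms(5,6)] mult.assoc)
  qed
  also have "\<dots> = e * signed_det e N ?g"
    by (simp add: signed_det_def sum_distrib_left)
  finally have "e * signed_det e N (f(m := unit_row l)) = (e * e) * signed_det e N ?g"
    by (simp add: mult.assoc)
  then show ?thesis using assms(6) by simp
qed

text \<open>
  Merging two columns turns a difference of cofactors of row \<open>m\<close> into a single determinant. Off
  row \<open>m\<close>, column \<open>l\<close> becomes a combination of columns \<open>l\<close> and \<open>k\<close>; by linearity, column \<open>l\<close> itself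
  gives the cofactor at \<open>k\<close>, and column \<open>k\<close> moved to position \<open>l\<close> gives the cofactor at \<open>l\<close> with the
  opposite sign.
\<close>
lemma signed_det_merge_columns:
  assumes "finite N" "m \<in> N" "k \<in> N" "l \<in> N" "k \<noteq> l" "e * e = 1"
  shows "signed_det e N ((\<lambda>i j. if j = l then a * f i l + b * f i k else f i j)(m := unit_row k))
    = a * signed_det e N (f(m := unit_row k)) + e * (b * signed_det e N (f(m := unit_row l)))"
proof -
  let ?f = "f(m := unit_row k)"
  let ?d = "\<lambda>i. if i = m then 0 else f i k"
  \<comment> \<open>The unit row has the entry \<open>0\<close> in column \<open>l\<close>, which is why the second summand must vanish in
    row \<open>m\<close> and cannot simply be column \<open>k\<close> of \<open>?f\<close>.\<close>
  have "(\<lambda>i j. if j = l then a * f i l + b * f i k else f i j)(m := unit_row k)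
      = (\<lambda>i j. if j = l then a * ?f i l + b * ?d i else ?f i j)"
    using assms(5) by (auto simp: fun_eq_iff unit_row_def)
  then have "signed_det e N ((\<lambda>i j. if j = l then a * f i l + b * f i k else f i j)(m := unit_row k))
    = a * signed_det e N (\<lambda>i j. if j = l then ?f i l else ?f i j)
      + b * signed_det e N (\<lambda>i j. if j = l then ?d i else ?f i j)"
    by (simp only: signed_det_column_linear[OF assms(1,4)])
  moreover have "(\<lambda>i j. if j = l then ?f i l else ?f i j) = ?f" by (auto simp: fun_eq_iff)
  moreover have "(\<lambda>i j. if j = l then ?d i else ?f i j)
      = (\<lambda>i j. if j = l then f i k else f i j)(m := unit_row k)"
    using assms(5) by (auto simp: fun_eq_iff unit_row_def)
  ultimately show ?thesis by (simp only: signed_det_swap_unit[OF assms] mult.left_commute)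
qed

section \<open>Arithmetic in a semiring triple\<close>

context semiring_triple
begin

lemma neg_eq_mult: "neg b = neg 1 * b"
  using neg_mult_left[OF one_in_T, of b] by simp

lemma neg_one_square: "neg 1 * neg 1 = 1"
  using neg_eq_mult[of "neg 1"] neg_neg[of 1] by simp

text \<open>
  \<open>A0\<close> absorbs \<open>T\<close>, and \<open>T\<close> together with \<open>0\<close> spans the semiring.
\<close>
lemma A0_ideal:
  assumes "x \<in> A0"
  shows "b * x \<in> A0"
proof -
  obtain xs where xs: "set xs \<subseteq> insert 0 T" "b = sum_list xs" using spanning by blast
  from xs(1) have "sum_list xs * x \<in> A0"
  proof (induction xs)
    case Nil show ?case by (simp add: zero_in_A0)
  next
    case (Cons a xs)
    have "a * x \<in> A0" using Cons.prems assms mult_in_A0 zero_in_A0 by auto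
    then show ?case using Cons by (auto simp: distrib_right intro: add_in_A0)
  qed
  then show ?thesis using xs(2) by simp
qed

lemma A0_ideal_right: "x \<in> A0 \<Longrightarrow> x * b \<in> A0"
  using A0_ideal[of x b] by (simp add: mult.commute)

lemma sum_in_A0: "(\<And>i. i \<in> I \<Longrightarrow> f i \<in> A0) \<Longrightarrow> sum f I \<in> A0"
  by (induction I rule: infinite_finite_induct) (auto simp: zero_in_A0 intro: add_in_A0)

lemma prod_in_T: "(\<And>i. i \<in> I \<Longrightarrow> f i \<in> T) \<Longrightarrow> prod f I \<in> T"
  by (induction I rule: infinite_finite_induct) (auto simp: one_in_T intro: mult_in_T)

lemma balanced_iff: "balanced A0 neg b c \<longleftrightarrow> b + neg 1 * c \<in> A0"
  by (simp add: balanced_def neg_eq_mult[of c])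

lemma balanced_refl: "balanced A0 neg b b"
  using A0_ideal[OF one_neg_one, of b] by (simp add: balanced_iff distrib_left mult.commute)

lemma balanced_zero_right: "balanced A0 neg b 0 \<longleftrightarrow> b \<in> A0"
  by (simp add: balanced_def neg_zero)

lemma balanced_zero_left: "balanced A0 neg 0 b \<longleftrightarrow> b \<in> A0"
proof -
  have "b = neg 1 * (neg 1 * b)" by (simp add: mult.assoc[symmetric] neg_one_square)
  then show ?thesis using A0_ideal[of "neg 1 * b" "neg 1"] A0_ideal[of b "neg 1"]
    by (auto simp: balanced_iff)
qed

lemma balanced_mult:
  assumes "balanced A0 neg b c"
  shows "balanced A0 neg (a * b) (a * c)"
  using A0_ideal[OF assms[unfolded balanced_iff], of a]
  by (simp add: balanced_iff distrib_left mult.left_commute)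

text \<open>
  The indices are exchanged because the permutation acts on the rows in one
  definition and on the columns in the other.
\<close>
lemma triple_det_eq_signed_det:
  "triple_det neg M = signed_det (neg 1) {..<dim_row M} (\<lambda>i j. M $$ (j, i))"
  unfolding triple_det_def signed_det_def perm_sign_def
  by (intro sum.cong) (auto simp: neg_eq_mult[symmetric])

end

section \<open>Kernel vectors force singularity\<close>

locale balancing_triple = semiring_triple +
  assumes cancel_A0: "a \<in> T \<Longrightarrow> a * b \<in> A0 \<Longrightarrow> b \<in> A0"
    and multiply_balanced: "multiply_balanced T A0 neg"
    and weak_elimination: "weak_balance_elimination T A0 neg"
begin

lemma balance_eliminate_sum:
  assumes "finite S" "\<And>k. k \<in> S \<Longrightarrow> a k \<in> T"
    and "\<And>k. k \<in> S \<Longrightarrow> balanced A0 neg (a k) (c k)"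
    and "(\<Sum>k\<in>S. b k * a k) \<in> A0"
  shows "(\<Sum>k\<in>S. b k * c k) \<in> A0"
proof -
  obtain h where h: "bij_betw h {..<card S} S"
    using ex_bij_betw_nat_finite[OF assms(1)] by (auto simp: atLeast0LessThan)
  have hS: "h j \<in> S" if "j < card S" for j using h that by (auto dest: bij_betwE)
  have "balanced A0 neg (\<Sum>j<card S. b (h j) * a (h j)) 0"
    using assms(4) sum.reindex_bij_betw[OF h, of "\<lambda>k. b k * a k"]
    by (simp add: balanced_zero_right)
  then have "balanced A0 neg (\<Sum>j<card S. b (h j) * c (h j)) 0"
    using weak_elimination[unfolded weak_balance_elimination_def, rule_format,
        of "card S" "\<lambda>j. a (h j)" "\<lambda>j. b (h j)" 0 "\<lambda>j. c (h j)"] assms(2,3) hS by auto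
  then show ?thesis
    using sum.reindex_bij_betw[OF h, of "\<lambda>k. b k * c k"] by (simp add: balanced_zero_right)
qed

text \<open>
  The set \<open>R\<close> contains the rows that may still be nonzero on the support of \<open>x\<close>, and the induction
  removes one row from it at a time. When \<open>R\<close> is empty, each column in the support is zero. A row
  outside \<open>R\<close> stays zero on the support under both modifications used in the step: merging columns
  \<open>k\<close> and \<open>l\<close> of the support only combines zeros, and the new unit row at \<open>k\<close> is harmless because
  \<open>k\<close> is not, or no longer, in the support.
\<close>
lemma signed_det_kernel_in_A0:
  assumes "finite N" "R \<subseteq> N"
    and "\<And>j. j \<in> N \<Longrightarrow> x j \<in> insert 0 T" "\<exists>q\<in>N. x q \<noteq> 0"
    and "\<And>i j. i \<in> N - R \<Longrightarrow> j \<in> N \<Longrightarrow> x j \<noteq> 0 \<Longrightarrow> f i j = 0"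
    and "\<And>i. i \<in> R \<Longrightarrow> (\<Sum>j\<in>N. f i j * x j) \<in> A0"
  shows "signed_det (neg 1) N f \<in> A0"
proof -
  have "finite R" using assms(1,2) by (rule finite_subset[rotated])
  then show ?thesis using assms(2-)
  proof (induction R arbitrary: f x rule: finite_induct)
    case empty
    then obtain q where "q \<in> N" "x q \<noteq> 0" by blast
    then have "signed_det (neg 1) N f = 0"
      using empty.prems(4) by (intro signed_det_zero_column[OF assms(1)]) auto
    then show ?case by (simp add: zero_in_A0)
  next
    case (insert m R)
    let ?e = "neg 1"
    define S where "S = {j \<in> N. x j \<noteq> 0}"
    define D where "D k = signed_det ?e N (f(m := unit_row k))" for k
    define y where "y k = prod x (S - {k})" for k
    define P where "P = prod x S"
    have m: "m \<in> N" and RN: "R \<subseteq> N" using insert.prems by auto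
    have xT: "x j \<in> T" if "j \<in> S" for j
      using insert.prems(2) that by (auto simp: S_def)
    have fS: "finite S" and SN: "S \<subseteq> N" using assms(1) by (auto simp: S_def)
    have yT: "y k \<in> T" for k unfolding y_def by (intro prod_in_T xT) auto
    have PT: "P \<in> T" unfolding P_def by (intro prod_in_T xT)

    \<comment> \<open>A unit row at a position off the support is itself zero on the support, so \<open>x\<close> can be reused.\<close>
    have off_support: "D k \<in> A0" if k: "k \<in> N - S" for k
      unfolding D_def
    proof (rule insert.IH[where x = x])
      fix i j assume "i \<in> N - R" "j \<in> N" "x j \<noteq> 0"
      then show "(f(m := unit_row k)) i j = 0"
        using insert.prems(4)[of i j] k by (auto simp: unit_row_def S_def)
    next
      fix i assume "i \<in> R"
      then show "(\<Sum>j\<in>N. (f(m := unit_row k)) i j * x j) \<in> A0"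
        using insert.prems(5)[of i] insert.hyps(2) by auto
    qed (use insert.prems RN in auto)

    \<comment> \<open>The merged column counts once with coefficient \<open>1\<close> and so contributes \<open>x l\<close> times column \<open>l\<close>
      plus \<open>x k\<close> times column \<open>k\<close>, as before; every row in \<open>R\<close> keeps its relation.\<close>
    have cramer: "x l * D k + ?e * (x k * D l) \<in> A0"
      if k: "k \<in> S" and l: "l \<in> S" and kl: "k \<noteq> l" for k l
    proof -
      let ?g = "(\<lambda>i j. if j = l then x l * f i l + x k * f i k else f i j)(m := unit_row k)"
      let ?x = "x(k := 0, l := 1)"
      have kN: "k \<in> N" and lN: "l \<in> N" and xk: "x k \<noteq> 0" and xl: "x l \<noteq> 0"
        using k l by (auto simp: S_def)
      have "signed_det ?e N ?g \<in> A0"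
      proof (rule insert.IH[where x = ?x])
        show "\<exists>q\<in>N. ?x q \<noteq> 0" using lN by (intro bexI[of _ l]) simp_all
      next
        fix j assume "j \<in> N"
        then show "?x j \<in> insert 0 T" using insert.prems(2) one_in_T by auto
      next
        fix i j assume ij: "i \<in> N - R" "j \<in> N" "?x j \<noteq> 0"
        show "?g i j = 0"
        proof (cases "i = m")
          case True
          then show ?thesis using ij(3) kl by (auto simp: unit_row_def split: if_splits)
        next
          case False
          then have "f i j' = 0" if "j' \<in> S" for j'
            using that ij(1) insert.prems(4)[of i j'] by (auto simp: S_def)
          moreover have "j = l \<or> j \<in> S" using ij by (auto simp: S_def split: if_splits)
          ultimately show ?thesis using False k l by auto
        qed
      next
        fix i assume i: "i \<in> R"
        then have im: "i \<noteq> m" using insert.hyps(2) by auto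
        have split: "sum h N = h k + (h l + sum h (N - {k} - {l}))" for h :: "'b \<Rightarrow> 'a"
          using assms(1) kN lN kl by (simp add: sum.remove[of N k] sum.remove[of "N - {k}" l])
        have "(\<Sum>j\<in>N - {k} - {l}. ?g i j * ?x j) = (\<Sum>j\<in>N - {k} - {l}. f i j * x j)"
          using im by (intro sum.cong) auto
        then have "(\<Sum>j\<in>N. ?g i j * ?x j) = (\<Sum>j\<in>N. f i j * x j)"
          unfolding split using im kl by (simp add: algebra_simps)
        then show "(\<Sum>j\<in>N. ?g i j * ?x j) \<in> A0"
          using insert.prems(5) i by auto
      qed (use RN in auto)
      then show ?thesis
        unfolding D_def
        using signed_det_merge_columns[OF assms(1) m kN lN kl neg_one_square, of "x l" f "x k"] by simp
    qed

    have "pairwise_balanced A0 neg ((\<lambda>k. y k * D k) ` S)"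
      unfolding pairwise_balanced_def
    proof (clarsimp)
      fix k l assume k: "k \<in> S" and l: "l \<in> S"
      show "balanced A0 neg (y k * D k) (y l * D l)"
      proof (cases "k = l")
        case True then show ?thesis by (simp add: balanced_refl)
      next
        case False
        have "y k = prod x (S - {k} - {l}) * x l" "y l = prod x (S - {k} - {l}) * x k"
          using fS k l False
          by (simp_all add: y_def prod.remove[of "S - {k}" l] prod.remove[of "S - {l}" k]
              mult.commute Diff_insert[symmetric] insert_commute)
        then show ?thesis
          using balanced_mult[of "x l * D k" "x k * D l" "prod x (S - {k} - {l})"] cramer[OF k l False]
          by (simp add: balanced_iff mult.assoc)
      qed
    qed
    then obtain t where t: "t \<in> insert 0 T" "\<And>k. k \<in> S \<Longrightarrow> balanced A0 neg t (y k * D k)"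
      using multiply_balanced unfolding multiply_balanced_def by blast

    \<comment> \<open>On the support, \<open>t\<close> serves as the common ratio of \<open>P * D k\<close> and \<open>x k\<close>.\<close>
    have on_support: "(\<Sum>k\<in>S. f m k * D k) \<in> A0"
    proof (cases "t = 0")
      case True
      have "D k \<in> A0" if "k \<in> S" for k
        using t(2)[OF that] True yT cancel_A0 by (auto simp: balanced_zero_left)
      then show ?thesis by (intro sum_in_A0 A0_ideal)
    next
      case False
      then have tT: "t \<in> T" using t(1) by simp
      have "(\<Sum>k\<in>S. f m k * (P * D k)) \<in> A0"
      proof (rule balance_eliminate_sum[OF fS, of "\<lambda>k. x k * t"])
        fix k assume k: "k \<in> S"
        then show "x k * t \<in> T" using xT tT by (intro mult_in_T)
        have "P = x k * y k" using fS k by (simp add: P_def y_def prod.remove)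
        then show "balanced A0 neg (x k * t) (P * D k)"
          using balanced_mult[OF t(2)[OF k], of "x k"] by (simp add: mult.assoc)
      next
        have "(\<Sum>k\<in>S. f m k * x k) = (\<Sum>k\<in>N. f m k * x k)"
          using assms(1) by (intro sum.mono_neutral_left) (auto simp: S_def)
        then have "(\<Sum>k\<in>S. f m k * x k) * t \<in> A0"
          using insert.prems(5) by (intro A0_ideal_right) simp
        then show "(\<Sum>k\<in>S. f m k * (x k * t)) \<in> A0"
          by (simp add: sum_distrib_right mult.assoc)
      qed
      then have "P * (\<Sum>k\<in>S. f m k * D k) \<in> A0"
        by (simp add: sum_distrib_left mult.left_commute)
      then show ?thesis using PT cancel_A0 by blast
    qed

    have "signed_det ?e N f = (\<Sum>k\<in>N. f m k * D k)"
      unfolding D_def by (rule signed_det_expand_row[OF assms(1) m])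
    also have "\<dots> = (\<Sum>k\<in>N-S. f m k * D k) + (\<Sum>k\<in>S. f m k * D k)"
      by (rule sum.subset_diff[OF SN assms(1)])
    also have "\<dots> \<in> A0"
      by (intro add_in_A0 on_support sum_in_A0 A0_ideal off_support)
    finally show ?case .
  qed
qed

text \<open>
  A dependence that uses only part of the index set extends by zeros to a kernel vector on the
  whole of it.
\<close>
lemma signed_det_dependent_in_A0:
  assumes h: "bij_betw h N I" and N: "finite N"
    and I': "I' \<subseteq> I" "I' \<noteq> {}" and a: "\<And>r. r \<in> I' \<Longrightarrow> a r \<in> T"
    and sum0: "\<And>i. i \<in> N \<Longrightarrow> (\<Sum>r\<in>I'. a r * g i r) \<in> A0"
  shows "signed_det (neg 1) N (\<lambda>i j. g i (h j)) \<in> A0"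
proof (rule signed_det_kernel_in_A0[OF N order_refl])
  let ?x = "\<lambda>r. if r \<in> I' then a r else 0"
  have fI: "finite I" using h N bij_betw_finite by blast
  show "?x (h j) \<in> insert 0 T" for j using a by simp
  from I' obtain r where "r \<in> I'" "r \<in> I" by blast
  with h obtain q where "q \<in> N" "h q = r" by (metis bij_betw_iff_bijections)
  moreover have "?x r \<noteq> 0" using a[OF \<open>r \<in> I'\<close>] \<open>r \<in> I'\<close> zero_notin_T by auto
  ultimately show "\<exists>q\<in>N. ?x (h q) \<noteq> 0" by blast
  fix i assume i: "i \<in> N"
  have "(\<Sum>j\<in>N. g i (h j) * ?x (h j)) = (\<Sum>r\<in>I. g i r * ?x r)"
    by (rule sum.reindex_bij_betw[OF h])
  also have "\<dots> = (\<Sum>r\<in>I'. a r * g i r)"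
    using fI I' by (intro sum.mono_neutral_cong_right) (auto simp: mult.commute)
  finally show "(\<Sum>j\<in>N. g i (h j) * ?x (h j)) \<in> A0" using sum0[OF i] by simp
qed auto

end

section \<open>Independence of rows and columns of nonsingular submatrices\<close>
lemma bij_betw_pick:
  assumes "finite I"
  shows "bij_betw (pick I) {..<card I} I"
proof (rule bij_betw_imageI)
  show inj: "inj_on (pick I) {..<card I}"
    by (rule inj_on_inverseI[where g = "\<lambda>r. card {a \<in> I. a < r}"]) (simp add: card_pick_le)
  have "pick I ` {..<card I} \<subseteq> I" using pick_in_set_le by auto
  then show "pick I ` {..<card I} = I"
    using inj assms by (intro card_subset_eq) (auto simp: card_image)
qed

context balancing_triple
begin

text \<open>
  A dependence among rows in \<open>I\<close> holds in every column of \<open>M\<close>, in particular in the columns in \<open>J\<close>,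
  so it restricts to the submatrix and makes it singular. The argument for columns exchanges the
  roles of \<open>I\<close> and \<open>J\<close>.
\<close>
lemma nonsingular_submatrix_independent:
  assumes I: "I \<subseteq> {..<dim_row M}" and J: "J \<subseteq> {..<dim_col M}" and IJ: "card I = card J"
    and ns: "\<not> triple_singular A0 neg (submatrix M I J)"
  shows "\<not> vecs_dependent T A0 (dim_col M) (row M) I"
    and "\<not> vecs_dependent T A0 (dim_row M) (col M) J"
proof -
  let ?N = "{..<card I}" and ?e = "neg 1"
  have fI: "finite I" and fJ: "finite J" using I J finite_subset by auto
  have pI: "bij_betw (pick I) ?N I" and pJ: "bij_betw (pick J) ?N J"
    using bij_betw_pick[OF fI] bij_betw_pick[OF fJ] IJ by simp_all
  have pIlt: "pick I i < dim_row M" and pJlt: "pick J i < dim_col M" if "i \<in> ?N" for i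
    using I J bij_betwE[OF pI] bij_betwE[OF pJ] that by auto
  have eqs: "{i. i < dim_row M \<and> i \<in> I} = I" "{j. j < dim_col M \<and> j \<in> J} = J"
    using I J by auto
  have "triple_det neg (submatrix M I J)
      = signed_det ?e ?N (\<lambda>i j. submatrix M I J $$ (j, i))"
    by (simp add: triple_det_eq_signed_det dim_submatrix eqs)
  also have "\<dots> = signed_det ?e ?N (\<lambda>i j. M $$ (pick I j, pick J i))"
    by (rule signed_det_cong, subst submatrix_index) (auto simp: eqs IJ)
  finally have det: "signed_det ?e ?N (\<lambda>i j. M $$ (pick I j, pick J i)) \<notin> A0"
    using ns by (simp add: triple_singular_def)
  then have det': "signed_det ?e ?N (\<lambda>i j. M $$ (pick I i, pick J j)) \<notin> A0"
    using signed_det_transpose[of ?N ?e "\<lambda>i j. M $$ (pick I i, pick J j)"] by simp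
  show "\<not> vecs_dependent T A0 (dim_col M) (row M) I"
  proof
    assume "vecs_dependent T A0 (dim_col M) (row M) I"
    then obtain I' a where I': "I' \<subseteq> I" "I' \<noteq> {}" "\<forall>r\<in>I'. a r \<in> T"
      and s: "\<And>k. k < dim_col M \<Longrightarrow> (\<Sum>r\<in>I'. a r * row M r $ k) \<in> A0"
      unfolding vecs_dependent_def by blast
    have "(\<Sum>r\<in>I'. a r * M $$ (r, pick J i)) \<in> A0" if "i \<in> ?N" for i
    proof -
      have "(\<Sum>r\<in>I'. a r * row M r $ pick J i) = (\<Sum>r\<in>I'. a r * M $$ (r, pick J i))"
        using I' I pJlt[OF that] by (intro sum.cong) auto
      then show ?thesis using s[OF pJlt[OF that]] by simp
    qed
    with I' have "signed_det ?e ?N (\<lambda>i j. M $$ (pick I j, pick J i)) \<in> A0"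
      by (intro signed_det_dependent_in_A0[OF pI, of I' a "\<lambda>i r. M $$ (r, pick J i)"]) auto
    with det show False ..
  qed
  show "\<not> vecs_dependent T A0 (dim_row M) (col M) J"
  proof
    assume "vecs_dependent T A0 (dim_row M) (col M) J"
    then obtain J' a where J': "J' \<subseteq> J" "J' \<noteq> {}" "\<forall>r\<in>J'. a r \<in> T"
      and s: "\<And>k. k < dim_row M \<Longrightarrow> (\<Sum>r\<in>J'. a r * col M r $ k) \<in> A0"
      unfolding vecs_dependent_def by blast
    have "(\<Sum>r\<in>J'. a r * M $$ (pick I i, r)) \<in> A0" if "i \<in> ?N" for i
    proof -
      have "(\<Sum>r\<in>J'. a r * col M r $ pick I i) = (\<Sum>r\<in>J'. a r * M $$ (pick I i, r))"
        using J' J pIlt[OF that] by (intro sum.cong) auto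
      then show ?thesis using s[OF pIlt[OF that]] by simp
    qed
    with J' have "signed_det ?e ?N (\<lambda>i j. M $$ (pick I i, pick J j)) \<in> A0"
      by (intro signed_det_dependent_in_A0[OF pJ, of J' a "\<lambda>i r. M $$ (pick I i, r)"]) auto
    with det' show False ..
  qed
qed

end

theorem theorem13:
  fixes T A0 :: "'a::comm_semiring_1 set" and neg :: "'a \<Rightarrow> 'a"
  assumes "semiring_triple T A0 neg"
    and "\<And>a b. a \<in> T \<Longrightarrow> a * b \<in> A0 \<Longrightarrow> b \<in> A0"
    and "\<And>a b1 b2. a \<in> T \<Longrightarrow> a * b1 = a * b2 \<Longrightarrow> b1 = b2"
    and "property_N T A0 neg"
    and "multiply_balanced T A0 neg"
    and "weak_balance_elimination T A0 neg"
  shows "condition_A1 T A0 neg"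
proof -
  interpret semiring_triple T A0 neg by (rule assms(1))
  interpret balancing_triple T A0 neg
    by unfold_locales (use assms(2,5,6) in blast)+
  show ?thesis
    unfolding condition_A1_def
  proof
    fix M :: "'a mat"
    let ?ranks = "{card I | I J. I \<subseteq> {..<dim_row M} \<and> J \<subseteq> {..<dim_col M} \<and> card I = card J \<and>
      \<not> triple_singular A0 neg (submatrix M I J)}"
    have "submatrix_rank A0 neg M \<in> ?ranks"
      unfolding submatrix_rank_def
      using submatrix_rank_set[of M] by (intro Max_in) auto
    then obtain I J where rank: "submatrix_rank A0 neg M = card I" and IJ: "card I = card J"
      and I: "I \<subseteq> {..<dim_row M}" and J: "J \<subseteq> {..<dim_col M}"
      and ns: "\<not> triple_singular A0 neg (submatrix M I J)"
      by blast
    have "card I \<le> triple_row_rank T A0 M"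
      unfolding triple_row_rank_def
      using I nonsingular_submatrix_independent(1)[OF I J IJ ns]
      by (intro Max_ge row_rank_set(1)) blast
    moreover have "card J \<le> triple_col_rank T A0 M"
      unfolding triple_col_rank_def
      using J nonsingular_submatrix_independent(2)[OF I J IJ ns]
      by (intro Max_ge col_rank_set(1)) blast
    ultimately show "submatrix_rank A0 neg M \<le> triple_row_rank T A0 M \<and>
        submatrix_rank A0 neg M \<le> triple_col_rank T A0 M"
      using rank IJ by simp
  qed
qed

end
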